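(* Let $t_0\ge 1$. Suppose that $\gamma(t)=\frac{\alpha}{t^r}$ with $r\in(-1,0]$ and $\alpha>0$, and $\delta(t)=\frac{t}{2r_0}$ with $r_0>\frac{r+1}{2}$. Suppose that $(x(t),y(t),\lambda(t))$ is a global solution of the dynamical system (S) (given in the context) and $(x^*,y^*,\lambda^* )\in\Omega$. Then: (a) $\mathcal{L}(x(t),y(t),\lambda^* )-\mathcal{L}(x^*,y^*,\lambda^* )=\mathcal{O}(t^{-(r+1)})$. (b) $\|Ax(t)+By(t)-b\|=\mathcal{O}(t^{-\frac{r+1}{2}})$. (c) $\int_{t_0}^{+\infty}t^r\|Ax(t)+By(t)-b\|^2\,dt<+\infty$. (d) $\int_{t_0}^{+\infty}t^r\big(\mathcal{L}(x(t),y(t),\lambda^* )-\mathcal{L}(x^*,y^*,\lambda^* )\big)\,dt<+\infty$. (e) $\int_{t_0}^{+\infty}t\big(\|\dot x(t)\|^2+\|\dot y(t)\|^2+\|\dot\lambda(t)\|^2\big)\,dt<+\infty$. (f) $\|\dot x(t)\|+\|\dot y(t)\|+\|\dot\lambda(t)\|=\mathcal{O}(t^{-\frac{r+1}{2}})$.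
   Context: All spaces are Euclidean with inner product $\langle\cdot,\cdot\rangle$ and norm $\|\cdot\|$. $f:\mathbb{R}^{n_1}\to\mathbb{R}$ and $g:\mathbb{R}^{n_2}\to\mathbb{R}$ are smooth (continuously differentiable) convex functions, $A\in\mathbb{R}^{m\times n_1}$, $B\in\mathbb{R}^{m\times n_2}$, $b\in\mathbb{R}^m$. $\Omega$ is the set of $(x^*,y^*,\lambda^* )\in\mathbb{R}^{n_1}\times\mathbb{R}^{n_2}\times\mathbb{R}^m$ with $-A^T\lambda^*=\nabla f(x^* )$, $-B^T\lambda^*=\nabla g(y^* )$, $Ax^*+By^*-b=0$; it is assumed that $\Omega\neq\emptyset$. The augmented Lagrangian is $$\mathcal{L}(x,y,\lambda)=f(x)+g(y)+\langle\lambda,Ax+By-b\rangle+\tfrac12\|Ax+By-b\|^2.$$ The dynamical system (S) is $$\begin{cases}\ddot{x}(t)+\gamma(t)\dot{x}(t)=-\nabla f(x(t))-A^T(\lambda(t)+\delta(t)\dot\lambda(t))-A^T(Ax(t)+By(t)-b),\\ \ddot{y}(t)+\gamma(t)\dot{y}(t)=-\nabla g(y(t))-B^T(\lambda(t)+\delta(t)\dot\lambda(t))-B^T(Ax(t)+By(t)-b),\\ \ddot{\lambda}(t)+\gamma(t)\dot{\lambda}(t)=A(x(t)+\delta(t)\dot{x}(t))+B(y(t)+\delta(t)\dot{y}(t))-b.\end{cases}$$ A global solution is a triple of $C^2$ functions on $[t_0,+\infty)$ satisfying (S) for all $t\ge t_0$. All $\mathcal{O}(\cdot)$ statements are as $t\to+\infty$.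 *)

theory Defs
  imports "HOL-Analysis.Analysis" "HOL-Library.Landau_Symbols"
begin

definition gradient :: "('a::real_inner \<Rightarrow> real) \<Rightarrow> 'a \<Rightarrow> 'a" where
  "gradient f x = (THE D. GDERIV f x :> D)"

lemma gradient_eqI:
  assumes "GDERIV f x :> D"
  shows "gradient f x = D"
  unfolding gradient_def
proof (rule the_equality)
  show "GDERIV f x :> D" by (rule assms)
next
  fix D' assume "GDERIV f x :> D'"
  then have "(\<lambda>h. inner h D') = (\<lambda>h. inner h D)"
    using assms has_derivative_unique unfolding gderiv_def by blast
  then have "inner h (D' - D) = 0" for h
    by (simp add: inner_diff_right fun_eq_iff)
  then show "D' = D"
    using inner_eq_zero_iff[of "D' - D"] by simp
qed

lemma gderiv_gradient:
  fixes f :: "'a::euclidean_space \<Rightarrow> real"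
  assumes "f differentiable (at x)"
  shows "GDERIV f x :> gradient f x"
proof -
  obtain f' where f': "(f has_derivative f') (at x)"
    using assms by (auto simp: differentiable_def)
  interpret bounded_linear f' using f' by (rule has_derivative_bounded_linear)
  define D where "D = (\<Sum>i\<in>Basis. f' i *\<^sub>R i)"
  have "f' h = inner h D" for h
  proof -
    have "f' h = f' (\<Sum>i\<in>Basis. inner h i *\<^sub>R i)"
      by (simp add: euclidean_representation)
    also have "\<dots> = (\<Sum>i\<in>Basis. inner h i * f' i)"
      by (simp add: sum scaleR)
    finally show ?thesis by (simp add: D_def inner_sum_right mult.commute)
  qed
  then have "f' = (\<lambda>h. inner h D)" by blast
  with f' have "GDERIV f x :> D" by (simp add: gderiv_def)
  then show ?thesis using gradient_eqI by metis
qed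

definition continuously_differentiable :: "('a::real_inner \<Rightarrow> real) \<Rightarrow> bool" where
  "continuously_differentiable f \<longleftrightarrow>
     (\<forall>x. f differentiable (at x)) \<and> continuous_on UNIV (gradient f)"

text \<open>Time derivative on the half-line from \<open>t0\<close>: two-sided for \<open>t > t0\<close>, one-sided at \<open>t0\<close>.\<close>

definition time_deriv :: "real \<Rightarrow> (real \<Rightarrow> 'a::real_normed_vector) \<Rightarrow> real \<Rightarrow> 'a" where
  "time_deriv t0 x t = vector_derivative x (at t within {t0..})"

lemma time_deriv_eqI:
  assumes "(x has_vector_derivative v) (at t within {t0..})" "t0 \<le> t"
  shows "time_deriv t0 x t = v"
proof -
  have "t islimpt {t..t+1}" by (simp add: islimpt_Icc)
  then have "t islimpt {t0..}"
    by (rule islimpt_subset) (use assms(2) in auto)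
  then have "at t within {t0..} \<noteq> bot"
    using trivial_limit_within by blast
  then show ?thesis
    using assms(1) unfolding time_deriv_def by (rule vector_derivative_within)
qed

definition C2_from :: "real \<Rightarrow> (real \<Rightarrow> 'a::real_normed_vector) \<Rightarrow> bool" where
  "C2_from t0 x \<longleftrightarrow>
     x differentiable_on {t0..} \<and>
     time_deriv t0 x differentiable_on {t0..} \<and>
     continuous_on {t0..} (time_deriv t0 (time_deriv t0 x))"

definition Omega ::
  "(real^'n1 \<Rightarrow> real) \<Rightarrow> (real^'n2 \<Rightarrow> real) \<Rightarrow>
   real^'n1^'m \<Rightarrow> real^'n2^'m \<Rightarrow> real^'m \<Rightarrow>
   ((real^'n1) \<times> (real^'n2) \<times> (real^'m)) set" where
  "Omega f g A B b = {(x, y, l).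
     - (transpose A *v l) = gradient f x \<and>
     - (transpose B *v l) = gradient g y \<and>
     A *v x + B *v y - b = 0}"

definition aug_Lagrangian ::
  "(real^'n1 \<Rightarrow> real) \<Rightarrow> (real^'n2 \<Rightarrow> real) \<Rightarrow>
   real^'n1^'m \<Rightarrow> real^'n2^'m \<Rightarrow> real^'m \<Rightarrow>
   real^'n1 \<Rightarrow> real^'n2 \<Rightarrow> real^'m \<Rightarrow> real" where
  "aug_Lagrangian f g A B b x y l =
     f x + g y + inner l (A *v x + B *v y - b)
       + 1/2 * (norm (A *v x + B *v y - b))\<^sup>2"

definition global_solution ::
  "(real^'n1 \<Rightarrow> real) \<Rightarrow> (real^'n2 \<Rightarrow> real) \<Rightarrow>
   real^'n1^'m \<Rightarrow> real^'n2^'m \<Rightarrow> real^'m \<Rightarrow>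
   (real \<Rightarrow> real) \<Rightarrow> (real \<Rightarrow> real) \<Rightarrow> real \<Rightarrow>
   (real \<Rightarrow> real^'n1) \<Rightarrow> (real \<Rightarrow> real^'n2) \<Rightarrow> (real \<Rightarrow> real^'m) \<Rightarrow> bool" where
  "global_solution f g A B b \<gamma> \<delta> t0 x y l \<longleftrightarrow>
     C2_from t0 x \<and> C2_from t0 y \<and> C2_from t0 l \<and>
     (let x' = time_deriv t0 x; y' = time_deriv t0 y; l' = time_deriv t0 l in
      \<forall>t\<ge>t0.
        time_deriv t0 x' t + \<gamma> t *\<^sub>R x' t =
          - gradient f (x t) - transpose A *v (l t + \<delta> t *\<^sub>R l' t)
          - transpose A *v (A *v x t + B *v y t - b) \<and>
        time_deriv t0 y' t + \<gamma> t *\<^sub>R y' t =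
          - gradient g (y t) - transpose B *v (l t + \<delta> t *\<^sub>R l' t)
          - transpose B *v (A *v x t + B *v y t - b) \<and>
        time_deriv t0 l' t + \<gamma> t *\<^sub>R l' t =
          A *v (x t + \<delta> t *\<^sub>R x' t) + B *v (y t + \<delta> t *\<^sub>R y' t) - b)"

end

theory Submission
  imports Defs
begin

text \<open>
  The proof is a Lyapunov argument. Put \<open>k = 1 / (2 * r0)\<close>, so that \<open>\<delta> t = k * t\<close>, and let
  \<open>K t\<close> be the Lagrangian gap and \<open>R t = A *v x t + B *v y t - b\<close> the residual along the
  trajectory. Take the inner product of the equations of motion, for the three components
  together, with \<open>u - z + \<delta> t *\<^sub>R u'\<close>, where \<open>u\<close> is a component and \<open>z\<close> its value at the
  saddle point. The extrapolation by \<open>\<delta>\<close> in the system uses the same factor as this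
  multiplier. The primal-dual coupling is therefore skew and drops out (\<open>coupling_cancels\<close>).
  What remains on the right is minus the pairing of the gradient of the Lagrangian with the
  displacement, which by convexity is at most \<open>- K t - (norm (R t))\<^sup>2 / 2\<close>
  (\<open>Lagrangian_gradient_pairing\<close>), and \<open>- \<delta> t\<close> times the time derivative of \<open>K\<close>.

  Now multiply by the weight \<open>t powr r\<close>. The weighted friction coefficient becomes the constant
  \<open>\<alpha>\<close>, so the left-hand side is, up to terms of a definite sign, the derivative of a quadratic
  expression in \<open>u - z\<close> and \<open>u'\<close>, called \<open>component_energy\<close> below. The energy
  \<open>E t = k * t powr (r + 1) * K t\<close> plus the three component energies then satisfies, for all
  large \<open>t\<close> and with \<open>N t\<close> the sum of the squared speeds,

  \<open>E' t \<le> - (1 - k * (r + 1)) * t powr r * K t - t powr r * (norm (R t))\<^sup>2 / 2 - \<alpha> * k / 2 * t * N t\<close>.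

  The condition \<open>r0 > (r + 1) / 2\<close> says exactly that the first coefficient is negative. The
  damping term dominates the other velocity terms because \<open>t powr r\<close> is bounded while \<open>t\<close>
  grows.

  For large \<open>t\<close> one also has
  \<open>E t \<ge> k * t powr (r + 1) * K t + k / 4 * t powr (r + 1) * N t\<close>
  (\<open>component_energy_lower_bound\<close>). Since \<open>E\<close> decreases, this gives the rates of \<open>K\<close> and \<open>N\<close>,
  and the rate of \<open>R\<close> follows from \<open>(norm (R t))\<^sup>2 \<le> 2 * K t\<close>
  (\<open>Lagrangian_gap_lower_bound\<close>). Since \<open>E\<close> is also nonnegative, the total dissipation is
  finite, which gives the three integrals (\<open>set_integrable_of_dissipation\<close>).
\<close>

section \<open>Convexity and the gradient\<close>

text \<open>
  On the line through \<open>x\<close> and \<open>y\<close> this is the tangent inequality for convex functions of one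
  real variable.
\<close>

lemma convex_on_above_gradient:
  fixes f :: "'a::real_inner \<Rightarrow> real"
  assumes conv: "convex_on UNIV f" and grad: "GDERIV f x :> D"
  shows "f x + inner D (y - x) \<le> f y"
proof -
  define h where "h s = f (x + s *\<^sub>R (y - x))" for s :: real
  have "convex_on UNIV h"
  proof (rule convex_onI)
    fix s u v :: real assume s: "0 < s" "s < 1"
    have "x + ((1 - s) *\<^sub>R u + s *\<^sub>R v) *\<^sub>R (y - x)
        = (1 - s) *\<^sub>R (x + u *\<^sub>R (y - x)) + s *\<^sub>R (x + v *\<^sub>R (y - x))"
      by (simp add: algebra_simps)
    then show "h ((1 - s) *\<^sub>R u + s *\<^sub>R v) \<le> (1 - s) * h u + s * h v"
      using convex_onD[OF conv, of s "x + u *\<^sub>R (y - x)" "x + v *\<^sub>R (y - x)"] s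
      by (simp add: h_def)
  qed simp
  moreover have "(h has_real_derivative inner (y - x) D) (at 0)"
  proof -
    have "(f has_derivative (\<lambda>v. inner v D)) (at (x + 0 *\<^sub>R (y - x)))"
      using grad by (simp add: gderiv_def)
    moreover have "((\<lambda>s. x + s *\<^sub>R (y - x)) has_vector_derivative (y - x)) (at 0)"
      by (auto intro!: derivative_eq_intros)
    ultimately show ?thesis
      using vector_derivative_diff_chain_within[of "\<lambda>s. x + s *\<^sub>R (y - x)" "y - x" 0 UNIV f "\<lambda>v. inner v D"]
      by (simp add: h_def[abs_def] o_def has_real_derivative_iff_has_vector_derivative has_derivative_at_withinI)
  qed
  ultimately have "h 1 - h 0 \<ge> inner (y - x) D * (1 - 0)"
    by (intro convex_on_imp_above_tangent[where A = UNIV]) auto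
  then show ?thesis by (simp add: h_def inner_commute)
qed

section \<open>Integrability from a dissipation inequality\<close>

text \<open>
  With \<open>h\<close> equal to zero this is the monotonicity of \<open>\<Phi>\<close> under one-sided differentiability at
  the left endpoint.
\<close>
lemma dissipation_integral_bound:
  fixes h \<Phi> \<Phi>' :: "real \<Rightarrow> real"
  assumes Tv: "T \<le> v" and h: "h integrable_on {T..v}"
    and deriv: "\<And>t. T \<le> t \<Longrightarrow> (\<Phi> has_real_derivative \<Phi>' t) (at t within {T..})"
    and diss: "\<And>t. T \<le> t \<Longrightarrow> \<Phi>' t \<le> - h t"
  shows "integral {T..v} h \<le> \<Phi> T - \<Phi> v"
proof -
  have "(\<Phi> has_vector_derivative \<Phi>' t) (at t within {T..v})" if "t \<in> {T..v}" for t
    using DERIV_subset[OF deriv, of t "{T..v}"] that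
    by (auto simp: has_real_derivative_iff_has_vector_derivative)
  then have "(\<Phi>' has_integral \<Phi> v - \<Phi> T) {T..v}"
    using Tv by (intro fundamental_theorem_of_calculus) auto
  then have "((\<lambda>t. - \<Phi>' t) has_integral - (\<Phi> v - \<Phi> T)) {T..v}"
    by (rule has_integral_neg)
  with integrable_integral[OF h] have "integral {T..v} h \<le> - (\<Phi> v - \<Phi> T)"
    by (rule has_integral_le) (use diss in \<open>auto simp: le_minus_iff\<close>)
  then show ?thesis by simp
qed

text \<open>
  A nonnegative \<open>\<Phi>\<close> can lose at most \<open>\<Phi> T\<close>, so the integrals of \<open>h\<close> over \<open>{T..v}\<close> are bounded
  uniformly in \<open>v\<close> and monotone convergence applies. The dissipation is only required from \<open>T\<close>
  on; on the compact interval \<open>{a..T}\<close> continuity suffices.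
\<close>
lemma set_integrable_of_dissipation:
  fixes h \<Phi> \<Phi>' :: "real \<Rightarrow> real"
  assumes cont: "continuous_on {a..} h" and aT: "a \<le> T" and c: "0 < c"
    and h0: "\<And>t. T \<le> t \<Longrightarrow> 0 \<le> h t"
    and deriv: "\<And>t. T \<le> t \<Longrightarrow> (\<Phi> has_real_derivative \<Phi>' t) (at t within {T..})"
    and diss: "\<And>t. T \<le> t \<Longrightarrow> \<Phi>' t \<le> - (c * h t)"
    and pos: "\<And>t. T \<le> t \<Longrightarrow> 0 \<le> \<Phi> t"
  shows "set_integrable lborel {a..} h"
proof -
  have intbl: "set_integrable lborel {u..v} h" if "a \<le> u" for u v
    using cont that by (intro borel_integrable_atLeastAtMost') (auto elim: continuous_on_subset)
  have val: "(LINT t:{T..v}|lborel. h t) = integral {T..v} h" for v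
    using intbl[OF aT] by (rule set_borel_integral_eq_integral(2))
  have bound: "integral {T..v} h \<le> \<Phi> T / c" if "T \<le> v" for v
  proof -
    have "(\<lambda>t. c * h t) integrable_on {T..v}"
      using set_borel_integral_eq_integral(1)[OF intbl[OF aT]] by (rule integrable_on_mult_right)
    then have "integral {T..v} (\<lambda>t. c * h t) \<le> \<Phi> T - \<Phi> v"
      using that deriv diss by (intro dissipation_integral_bound) auto
    then have "c * integral {T..v} h \<le> \<Phi> T" using pos[OF that] by simp
    then show ?thesis using c by (simp add: field_simps)
  qed
  define A where "A n = {T..T + real n}" for n :: nat
  define I where "I n = (LINT t:A n|lborel. h t)" for n
  have "mono A" by (auto simp: mono_def A_def)
  have "mono I"
    unfolding mono_def
  proof (intro allI impI)
    fix m n :: nat assume "m \<le> n"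
    then show "I m \<le> I n"
      unfolding I_def A_def val
      by (intro integral_subset_le set_borel_integral_eq_integral(1) intbl aT) (auto simp: h0)
  qed
  moreover have "\<forall>n. I n \<le> \<Phi> T / c"
    using bound by (simp add: I_def A_def val)
  ultimately obtain L where "I \<longlonglongrightarrow> L"
    by (rule incseq_convergent)
  moreover have "(\<Union>n. A n) = {T..}"
  proof -
    have "t \<in> (\<Union>n. A n)" if "T \<le> t" for t
      using that real_arch_simple[of "t - T"] by (auto simp: A_def algebra_simps)
    then show ?thesis by (auto simp: A_def)
  qed
  moreover have "set_integrable lborel (\<Union>n. A n) h"
    using \<open>mono A\<close>
  proof (rule pos_integrable_to_top[rotated])
    show "(\<lambda>n. LINT t:A n|lborel. h t) \<longlonglongrightarrow> L"
      using \<open>I \<longlonglongrightarrow> L\<close> by (simp add: I_def[abs_def])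
  qed (auto simp: A_def h0 intbl[OF aT])
  ultimately have "set_integrable lborel {T..} h" by simp
  moreover have "{a..} = {a..T} \<union> {T..}" using aT by auto
  ultimately show ?thesis
    using set_integrable_Un[OF intbl[of a T]] by auto
qed

section \<open>The energy of one component\<close>

text \<open>
  This is what results when \<open>t powr r\<close> times the inner product of
  \<open>u'' + (\<alpha> / t powr r) *\<^sub>R u'\<close> with \<open>u - z + (k * t) *\<^sub>R u'\<close> is integrated by parts; here \<open>u'\<close>
  is meant to be the velocity of the curve \<open>u\<close>. The part \<open>- r * t powr (r - 1)\<close> of the last
  coefficient is minus the derivative of the weight \<open>t powr r\<close>. It absorbs the cross term between
  \<open>u'\<close> and \<open>u - z\<close> that arises when the weight in the first summand is differentiated.
\<close>
definition component_energy ::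
  "real \<Rightarrow> real \<Rightarrow> real \<Rightarrow> 'a::real_inner \<Rightarrow> (real \<Rightarrow> 'a) \<Rightarrow> (real \<Rightarrow> 'a) \<Rightarrow> real \<Rightarrow> real" where
  "component_energy \<alpha> r k z u u' t =
     t powr r * inner (u' t) (u t - z)
     + k * t powr (r + 1) / 2 * (norm (u' t))\<^sup>2
     + (\<alpha> - r * t powr (r - 1)) / 2 * (norm (u t - z))\<^sup>2"

text \<open>
  The first summand of the derivative is prescribed by the equation of motion, whose friction is
  \<open>\<alpha> / t powr r\<close>. For \<open>r \<le> 0\<close> the last one is nonpositive, and so is the middle one for large
  \<open>t\<close> if \<open>\<alpha>\<close> and \<open>k\<close> are positive.
\<close>
lemma component_energy_has_derivative:
  fixes u u' :: "real \<Rightarrow> 'a::real_inner"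
  assumes t: "0 < t"
    and u: "(u has_vector_derivative u' t) (at t within S)"
    and u': "(u' has_vector_derivative a) (at t within S)"
  shows "(component_energy \<alpha> r k z u u' has_real_derivative
      t powr r * inner (a + (\<alpha> / t powr r) *\<^sub>R u' t) (u t - z + (k * t) *\<^sub>R u' t)
      - (\<alpha> * k * t - (1 + k * (r + 1) / 2) * t powr r) * (norm (u' t))\<^sup>2
      - r * (r - 1) / 2 * t powr (r - 2) * (norm (u t - z))\<^sup>2) (at t within S)"
proof -
  have pw: "((\<lambda>s. s powr e) has_real_derivative e * t powr (e - 1)) (at t within S)" for e
    using has_real_derivative_powr[OF t, of e] by (rule has_field_derivative_at_within)
  have inn: "((\<lambda>s. inner (v s) (w s)) has_real_derivative inner (v t) w' + inner v' (w t)) (at t within S)"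
    if "(v has_vector_derivative v') (at t within S)" "(w has_vector_derivative w') (at t within S)"
    for v w :: "real \<Rightarrow> 'a" and v' w'
    unfolding has_field_derivative_def
    by (rule has_derivative_eq_rhs[OF has_derivative_inner[OF that[unfolded has_vector_derivative_def]]])
       (simp add: fun_eq_iff algebra_simps)
  define w where "w s = u s - z" for s
  have w: "(w has_vector_derivative u' t) (at t within S)"
    using u by (auto intro!: derivative_eq_intros simp: w_def[abs_def])
  define P where "P = t powr r"
  have P: "t powr (r + 1) = t * P" "t powr r = P" and P0: "P \<noteq> 0"
    using t by (simp_all add: P_def powr_add)
  have D1: "((\<lambda>s. s powr r * inner (u' s) (w s)) has_real_derivative
      r * t powr (r - 1) * inner (u' t) (w t) + (inner (u' t) (u' t) + inner a (w t)) * P)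
      (at t within S)"
    using DERIV_mult[OF pw[of r] inn[OF u' w]] by (simp add: P)
  have D2: "((\<lambda>s. k * s powr (r + 1) / 2 * inner (u' s) (u' s)) has_real_derivative
      k * ((r + 1) * P) / 2 * inner (u' t) (u' t)
      + (inner (u' t) a + inner a (u' t)) * (k * (t * P) / 2)) (at t within S)"
    using DERIV_mult[OF DERIV_cdivide[OF DERIV_cmult[OF pw[of "r + 1"]]] inn[OF u' u'], of k 2]
    by (simp add: P)
  have D3: "((\<lambda>s. (\<alpha> - r * s powr (r - 1)) / 2 * inner (w s) (w s)) has_real_derivative
      (0 - r * ((r - 1) * t powr (r - 2))) / 2 * inner (w t) (w t)
      + (inner (w t) (u' t) + inner (u' t) (w t)) * ((\<alpha> - r * t powr (r - 1)) / 2))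
      (at t within S)"
    using DERIV_mult[OF DERIV_cdivide[OF DERIV_diff[OF DERIV_const DERIV_cmult[OF pw[of "r - 1"]]]]
        inn[OF w w], of \<alpha> r 2]
    by simp
  have rhs: "P * inner (a + (\<alpha> / P) *\<^sub>R u' t) (w t + (k * t) *\<^sub>R u' t)
      = P * inner a (w t) + k * t * P * inner a (u' t) + \<alpha> * inner (u' t) (w t)
        + \<alpha> * k * t * inner (u' t) (u' t)"
    using P0 by (simp add: inner_add_left inner_add_right field_simps)
  show ?thesis
    unfolding component_energy_def[abs_def] power2_norm_eq_inner w_def[symmetric] P rhs
    by (rule DERIV_cong[OF DERIV_add[OF DERIV_add[OF D1 D2] D3]])
       (simp add: inner_commute[of a "u' t"] inner_commute[of "w t" "u' t"] field_simps)
qed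

text \<open>
  Completing the square in \<open>t powr r *\<^sub>R u' + \<alpha> *\<^sub>R (u - z)\<close> absorbs the indefinite inner product
  at the price of \<open>(t powr r)\<^sup>2 / (2 * \<alpha>) * (norm u')\<^sup>2\<close>. The threshold on \<open>t\<close> makes this at most
  half of the kinetic part.
\<close>
lemma component_energy_lower_bound:
  fixes u u' :: "real \<Rightarrow> 'a::real_inner"
  assumes "1 \<le> t" "r \<le> 0" "0 < \<alpha>" "0 < k" and large: "4 / (\<alpha> * k) \<le> t"
  shows "k / 4 * t powr (r + 1) * (norm (u' t))\<^sup>2 \<le> component_energy \<alpha> r k z u u' t"
proof -
  define P where "P = t powr r"
  have P: "t powr (r + 1) = P * t" "0 < P" "P \<le> 1"
    using assms by (auto simp: P_def powr_add powr_le_one_le intro: order_trans[OF powr_mono[of r 0]])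
  have "4 \<le> \<alpha> * k * t" using large assms by (simp add: field_simps)
  then have "2 * P * P \<le> \<alpha> * (k * (P * t))"
    using P mult_left_mono[of "2 * P" "\<alpha> * k * t" P] by (simp add: algebra_simps)
  then have quad: "P * P / (2 * \<alpha>) \<le> k / 4 * (P * t)"
    using assms by (simp add: field_simps)
  have "0 \<le> (norm (P *\<^sub>R u' t + \<alpha> *\<^sub>R (u t - z)))\<^sup>2 / (2 * \<alpha>)"
    using assms by simp
  also have "\<dots> = P * P / (2 * \<alpha>) * (norm (u' t))\<^sup>2 + P * inner (u' t) (u t - z)
      + \<alpha> / 2 * (norm (u t - z))\<^sup>2"
  proof -
    have "(norm (P *\<^sub>R a + \<alpha> *\<^sub>R c))\<^sup>2
        = P * P * (norm a)\<^sup>2 + 2 * \<alpha> * P * inner a c + \<alpha> * \<alpha> * (norm c)\<^sup>2" for a c :: 'a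
      unfolding power2_norm_eq_inner
      by (simp add: inner_add_left inner_add_right inner_commute[of c a] algebra_simps)
    from this[of "u' t" "u t - z"] show ?thesis
      using \<open>0 < \<alpha>\<close> by (simp add: add_divide_distrib)
  qed
  also have "\<dots> \<le> k / 4 * (P * t) * (norm (u' t))\<^sup>2 + P * inner (u' t) (u t - z)
      + (\<alpha> - r * t powr (r - 1)) / 2 * (norm (u t - z))\<^sup>2"
  proof -
    have "\<alpha> / 2 \<le> (\<alpha> - r * t powr (r - 1)) / 2"
      using \<open>r \<le> 0\<close> by (simp add: mult_nonpos_nonneg)
    from mult_right_mono[OF quad zero_le_power2] mult_right_mono[OF this zero_le_power2]
    show ?thesis by (meson add_mono order_refl)
  qed
  finally show ?thesis
    unfolding component_energy_def P(1) P_def[symmetric] by (simp add: algebra_simps)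
qed

section \<open>The augmented Lagrangian\<close>

lemma inner_transpose_mult:
  fixes A :: "real^'n^'m"
  shows "inner (transpose A *v w) v = inner w (A *v v)"
  by (simp add: dot_lmul_matrix)

text \<open>
  At a saddle point the plain Lagrangian with multiplier \<open>ls\<close> is minimal by convexity. The
  augmentation term is what is left of the gap.
\<close>
lemma Lagrangian_gap_lower_bound:
  fixes f :: "real^'n1 \<Rightarrow> real" and g :: "real^'n2 \<Rightarrow> real"
    and A :: "real^'n1^'m" and B :: "real^'n2^'m" and b ls :: "real^'m"
  assumes "convex_on UNIV f" "GDERIV f xs :> - (transpose A *v ls)"
    and "convex_on UNIV g" "GDERIV g ys :> - (transpose B *v ls)"
    and feas: "A *v xs + B *v ys - b = 0"
  shows "(norm (A *v x + B *v y - b))\<^sup>2 / 2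
    \<le> aug_Lagrangian f g A B b x y ls - aug_Lagrangian f g A B b xs ys ls"
proof -
  have "f xs - inner ls (A *v (x - xs)) \<le> f x"
    using convex_on_above_gradient[OF assms(1,2), of x]
    by (simp add: dot_lmul_matrix)
  moreover have "g ys - inner ls (B *v (y - ys)) \<le> g y"
    using convex_on_above_gradient[OF assms(3,4), of y]
    by (simp add: dot_lmul_matrix)
  moreover have "A *v x + B *v y - b = A *v (x - xs) + B *v (y - ys)"
    using feas by (simp add: matrix_vector_mult_diff_distrib algebra_simps)
  ultimately show ?thesis
    unfolding aug_Lagrangian_def by (simp add: feas inner_add_right)
qed

text \<open>
  The right-hand side pairs the gradient of the augmented Lagrangian with the
  displacement from a feasible point. The augmentation is a quadratic function of the residual,
  hence contributes twice its value; this surplus over the gap is \<open>(norm R)\<^sup>2 / 2\<close>.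
\<close>
lemma Lagrangian_gradient_pairing:
  fixes f :: "real^'n1 \<Rightarrow> real" and g :: "real^'n2 \<Rightarrow> real"
    and A :: "real^'n1^'m" and B :: "real^'n2^'m" and b ls :: "real^'m"
  assumes "convex_on UNIV f" "GDERIV f x :> Df"
    and "convex_on UNIV g" "GDERIV g y :> Dg"
    and feas: "A *v xs + B *v ys - b = 0"
  defines "R \<equiv> A *v x + B *v y - b"
  shows "aug_Lagrangian f g A B b x y ls - aug_Lagrangian f g A B b xs ys ls + (norm R)\<^sup>2 / 2
    \<le> inner (Df + transpose A *v (ls + R)) (x - xs) + inner (Dg + transpose B *v (ls + R)) (y - ys)"
proof -
  have "f x + inner Df (xs - x) \<le> f xs" "g y + inner Dg (ys - y) \<le> g ys"
    using assms convex_on_above_gradient by blast+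
  moreover have "inner (transpose A *v (ls + R)) (x - xs) + inner (transpose B *v (ls + R)) (y - ys)
      = inner ls R + (norm R)\<^sup>2"
  proof -
    have "R = A *v (x - xs) + B *v (y - ys)"
      using feas by (simp add: R_def matrix_vector_mult_diff_distrib algebra_simps)
    then have "inner (ls + R) R = inner (ls + R) (A *v (x - xs)) + inner (ls + R) (B *v (y - ys))"
      by (simp add: inner_add_right)
    then show ?thesis
      unfolding inner_transpose_mult power2_norm_eq_inner by (simp add: inner_add_left)
  qed
  ultimately show ?thesis
    unfolding aug_Lagrangian_def R_def[symmetric]
    by (simp add: feas inner_add_left inner_diff_right del: transpose_matrix_vector)
qed

lemma Lagrangian_has_derivative_along_curve:
  fixes f :: "real^'n1 \<Rightarrow> real" and g :: "real^'n2 \<Rightarrow> real"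
    and A :: "real^'n1^'m" and B :: "real^'n2^'m" and b ls :: "real^'m"
  assumes f: "GDERIV f (x t) :> Df" and g: "GDERIV g (y t) :> Dg"
    and x: "(x has_vector_derivative x') (at t within S)"
    and y: "(y has_vector_derivative y') (at t within S)"
  defines "R \<equiv> A *v x t + B *v y t - b"
  shows "((\<lambda>s. aug_Lagrangian f g A B b (x s) (y s) ls) has_real_derivative
      inner (Df + transpose A *v (ls + R)) x' + inner (Dg + transpose B *v (ls + R)) y')
      (at t within S)"
proof -
  have fx: "((\<lambda>s. f (x s)) has_derivative (\<lambda>h. inner (h *\<^sub>R x') Df)) (at t within S)"
    using has_derivative_compose[OF x[unfolded has_vector_derivative_def] f[unfolded gderiv_def]] .
  have gy: "((\<lambda>s. g (y s)) has_derivative (\<lambda>h. inner (h *\<^sub>R y') Dg)) (at t within S)"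
    using has_derivative_compose[OF y[unfolded has_vector_derivative_def] g[unfolded gderiv_def]] .
  have Ax: "((\<lambda>s. A *v x s) has_derivative (\<lambda>h. A *v (h *\<^sub>R x'))) (at t within S)"
    using x[unfolded has_vector_derivative_def] by (rule bounded_linear.has_derivative[OF matrix_vector_mul_bounded_linear])
  have By: "((\<lambda>s. B *v y s) has_derivative (\<lambda>h. B *v (h *\<^sub>R y'))) (at t within S)"
    using y[unfolded has_vector_derivative_def] by (rule bounded_linear.has_derivative[OF matrix_vector_mul_bounded_linear])
  show ?thesis
    unfolding aug_Lagrangian_def power2_norm_eq_inner has_field_derivative_def
    apply (rule has_derivative_eq_rhs)
     apply (rule derivative_intros fx gy Ax By)+
    apply (simp add: fun_eq_iff R_def[symmetric] inner_add_left inner_transpose_mult matrix_vector_mult_scaleR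
        inner_add_right del: transpose_matrix_vector)
    apply (simp add: algebra_simps inner_commute)
    done
qed

section \<open>The dynamics\<close>

text \<open>
  With \<open>w = l - ls + q *\<^sub>R l'\<close>, \<open>X = x - xs + q *\<^sub>R x'\<close> and \<open>Y = y - ys + q *\<^sub>R y'\<close> the coupling
  contributes \<open>- inner w (A *v X + B *v Y)\<close> through the two primal forces. By feasibility of
  \<open>(xs, ys)\<close> the dual force is \<open>A *v X + B *v Y\<close>, so it contributes the same with the opposite sign.
\<close>
lemma coupling_cancels:
  fixes A :: "real^'n1^'m" and B :: "real^'n2^'m" and b ls :: "real^'m"
    and x x' :: "real^'n1" and y y' :: "real^'n2"
  assumes feas: "A *v xs + B *v ys - b = 0"
  defines "R \<equiv> A *v x + B *v y - b"
  shows "inner (- Df - transpose A *v (l + q *\<^sub>R l') - transpose A *v R) (x - xs + q *\<^sub>R x')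
      + inner (- Dg - transpose B *v (l + q *\<^sub>R l') - transpose B *v R) (y - ys + q *\<^sub>R y')
      + inner (A *v (x + q *\<^sub>R x') + B *v (y + q *\<^sub>R y') - b) (l - ls + q *\<^sub>R l')
    = - (inner (Df + transpose A *v (ls + R)) (x - xs) + inner (Dg + transpose B *v (ls + R)) (y - ys))
      - q * (inner (Df + transpose A *v (ls + R)) x' + inner (Dg + transpose B *v (ls + R)) y')"
proof -
  define w where "w = l - ls + q *\<^sub>R l'"
  define X where "X = x - xs + q *\<^sub>R x'"
  define Y where "Y = y - ys + q *\<^sub>R y'"
  have lin: "A *v (x + q *\<^sub>R x') + B *v (y + q *\<^sub>R y') - b = A *v X + B *v Y"
    using feas by (simp add: X_def Y_def matrix_vector_mult_diff_distrib matrix_vector_right_distrib algebra_simps)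
  have "l + q *\<^sub>R l' = ls + w" by (simp add: w_def)
  then have a: "- D - transpose C *v (l + q *\<^sub>R l') - transpose C *v R
      = - (D + transpose C *v (ls + R)) - transpose C *v w" for D and C :: "real^'k^'m"
    by (simp add: matrix_vector_right_distrib algebra_simps del: transpose_matrix_vector)
  have cross: "inner (transpose A *v w) X + inner (transpose B *v w) Y = inner (A *v X + B *v Y) w"
    unfolding inner_transpose_mult by (simp add: inner_add_left inner_commute[of w])
  have GX: "inner D X = inner D (x - xs) + q * inner D x'" for D
    by (simp add: X_def inner_add_right)
  have HY: "inner D Y = inner D (y - ys) + q * inner D y'" for D
    by (simp add: Y_def inner_add_right)
  show ?thesis
    unfolding a lin X_def[symmetric] Y_def[symmetric] w_def[symmetric]
      inner_diff_left[of "- _"] inner_minus_left distrib_left[of q]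
    using cross GX[of "Df + transpose A *v (ls + R)"] HY[of "Dg + transpose B *v (ls + R)"]
    by linarith
qed

lemma C2_from_derivatives:
  assumes "C2_from t0 u" "t0 \<le> t"
  shows "(u has_vector_derivative time_deriv t0 u t) (at t within {t0..})"
    and "(time_deriv t0 u has_vector_derivative time_deriv t0 (time_deriv t0 u) t) (at t within {t0..})"
  using assms
  by (auto simp: C2_from_def differentiable_on_def time_deriv_def vector_derivative_works)

lemma C2_from_continuous:
  assumes "C2_from t0 u"
  shows "continuous_on {t0..} u" and "continuous_on {t0..} (time_deriv t0 u)"
  using assms by (auto simp: C2_from_def differentiable_imp_continuous_on)

section \<open>Convergence rates\<close>

lemma sqrt_rate:
  fixes a C t e :: real
  assumes "a\<^sup>2 \<le> C * t powr (- e)" "0 \<le> C"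
  shows "a \<le> sqrt C * t powr (- (e / 2))"
proof (rule power2_le_imp_le)
  have "(t powr (- (e / 2)))\<^sup>2 = t powr (- e)"
    by (simp add: power2_eq_square flip: powr_add)
  then show "a\<^sup>2 \<le> (sqrt C * t powr (- (e / 2)))\<^sup>2"
    using assms by (simp add: power_mult_distrib)
qed (use assms in simp)

theorem theorem3p2:
  fixes f :: "real^'n1 \<Rightarrow> real" and g :: "real^'n2 \<Rightarrow> real"
    and A :: "real^'n1^'m" and B :: "real^'n2^'m" and b :: "real^'m"
    and t0 \<alpha> r r0 :: real and \<gamma> \<delta> :: "real \<Rightarrow> real"
    and x :: "real \<Rightarrow> real^'n1" and y :: "real \<Rightarrow> real^'n2" and l :: "real \<Rightarrow> real^'m"
    and xs :: "real^'n1" and ys :: "real^'n2" and ls :: "real^'m"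
  assumes "convex_on UNIV f" and "continuously_differentiable f"
    and "convex_on UNIV g" and "continuously_differentiable g"
    and "t0 \<ge> 1"
    and "-1 < r" and "r \<le> 0" and "\<alpha> > 0" and "r0 > (r + 1) / 2"
    and "\<And>t. t \<ge> t0 \<Longrightarrow> \<gamma> t = \<alpha> / t powr r"
    and "\<And>t. t \<ge> t0 \<Longrightarrow> \<delta> t = t / (2 * r0)"
    and "global_solution f g A B b \<gamma> \<delta> t0 x y l"
    and "(xs, ys, ls) \<in> Omega f g A B b"
  shows
    "(\<lambda>t. aug_Lagrangian f g A B b (x t) (y t) ls - aug_Lagrangian f g A B b xs ys ls)
        \<in> O[at_top](\<lambda>t. t powr (- (r + 1))) \<and>
     (\<lambda>t. norm (A *v x t + B *v y t - b)) \<in> O[at_top](\<lambda>t. t powr (- ((r + 1) / 2))) \<and>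
     set_integrable lborel {t0..} (\<lambda>t. t powr r * (norm (A *v x t + B *v y t - b))\<^sup>2) \<and>
     set_integrable lborel {t0..} (\<lambda>t. t powr r *
        (aug_Lagrangian f g A B b (x t) (y t) ls - aug_Lagrangian f g A B b xs ys ls)) \<and>
     set_integrable lborel {t0..} (\<lambda>t. t *
        ((norm (time_deriv t0 x t))\<^sup>2 + (norm (time_deriv t0 y t))\<^sup>2
          + (norm (time_deriv t0 l t))\<^sup>2)) \<and>
     (\<lambda>t. norm (time_deriv t0 x t) + norm (time_deriv t0 y t) + norm (time_deriv t0 l t))
        \<in> O[at_top](\<lambda>t. t powr (- ((r + 1) / 2)))"
proof -
  define k where "k = 1 / (2 * r0)"
  have r0: "0 < r0" "r + 1 < 2 * r0"
    using \<open>-1 < r\<close> \<open>r0 > (r + 1) / 2\<close> by simp_all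
  then have k: "0 < k" "k * (r + 1) < 1" by (auto simp: k_def)
  have \<delta>: "\<delta> t = k * t" if "t0 \<le> t" for t
    using assms(11)[OF that] by (simp add: k_def)

  define x' where "x' = time_deriv t0 x"
  define y' where "y' = time_deriv t0 y"
  define l' where "l' = time_deriv t0 l"
  define R where "R t = A *v x t + B *v y t - b" for t
  define K where "K t = aug_Lagrangian f g A B b (x t) (y t) ls - aug_Lagrangian f g A B b xs ys ls" for t
  define N where "N t = (norm (x' t))\<^sup>2 + (norm (y' t))\<^sup>2 + (norm (l' t))\<^sup>2" for t
  define Gx where "Gx t = gradient f (x t) + transpose A *v (ls + R t)" for t
  define Gy where "Gy t = gradient g (y t) + transpose B *v (ls + R t)" for t

  have C2: "C2_from t0 x" "C2_from t0 y" "C2_from t0 l"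
    using assms(12) by (auto simp: global_solution_def)
  have df: "GDERIV f z :> gradient f z" for z
    using assms(2) by (auto simp: continuously_differentiable_def intro: gderiv_gradient)
  have dg: "GDERIV g z :> gradient g z" for z
    using assms(4) by (auto simp: continuously_differentiable_def intro: gderiv_gradient)
  have opt: "GDERIV f xs :> - (transpose A *v ls)" "GDERIV g ys :> - (transpose B *v ls)"
    and feas: "A *v xs + B *v ys - b = 0"
    using assms(13) df[of xs] dg[of ys] by (auto simp: Omega_def)

  have K_lower: "(norm (R t))\<^sup>2 / 2 \<le> K t" for t
    unfolding K_def R_def using assms(1,3) opt feas by (intro Lagrangian_gap_lower_bound)
  then have K_nonneg: "0 \<le> K t" for t
    by (rule order_trans[rotated]) simp
  have pairing: "K t + (norm (R t))\<^sup>2 / 2 \<le> inner (Gx t) (x t - xs) + inner (Gy t) (y t - ys)" for t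
    unfolding K_def Gx_def Gy_def R_def
    using assms(1,3) df dg feas by (intro Lagrangian_gradient_pairing)

  \<comment> \<open>From this time on the damping dominates and the energy is bounded below by its kinetic part.\<close>
  define T where "T = max t0 (4 / (\<alpha> * k))"
  have T: "t0 \<le> T" "4 / (\<alpha> * k) \<le> T" by (auto simp: T_def)
  define E where "E t = k * t powr (r + 1) * K t + (component_energy \<alpha> r k xs x x' t
      + component_energy \<alpha> r k ys y y' t + component_energy \<alpha> r k ls l l' t)" for t
  define V where "V t = (norm (x t - xs))\<^sup>2 + (norm (y t - ys))\<^sup>2 + (norm (l t - ls))\<^sup>2" for t
  define E' where "E' t = k * (r + 1) * t powr r * K t
      - t powr r * (inner (Gx t) (x t - xs) + inner (Gy t) (y t - ys))
      - (\<alpha> * k * t - (1 + k * (r + 1) / 2) * t powr r) * N t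
      - r * (r - 1) / 2 * t powr (r - 2) * V t" for t

  \<comment> \<open>The terms with the derivative of the gap cancel: the weight of the gap in \<open>E\<close> is
    \<open>t powr r\<close> times \<open>k * t\<close>, the factor with which that derivative enters the multiplied
    equations of motion.\<close>
  have E_deriv: "(E has_real_derivative E' t) (at t within {t0..})" if t: "t0 \<le> t" for t
  proof -
    have t_pos: "0 < t" using t \<open>t0 \<ge> 1\<close> by simp
    define K' where "K' = inner (Gx t) (x' t) + inner (Gy t) (y' t)"
    have DK: "(K has_real_derivative K') (at t within {t0..})"
      using DERIV_diff[OF Lagrangian_has_derivative_along_curve[OF df dg
          C2_from_derivatives(1)[OF C2(1) t] C2_from_derivatives(1)[OF C2(2) t]] DERIV_const]
      by (simp add: K_def[abs_def] K'_def Gx_def Gy_def R_def x'_def y'_def del: transpose_matrix_vector)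
    have DkK: "((\<lambda>s. k * s powr (r + 1) * K s) has_real_derivative
        k * (r + 1) * t powr r * K t + K' * (k * t powr (r + 1))) (at t within {t0..})"
      using DERIV_mult[OF DERIV_cmult[OF has_field_derivative_at_within[OF
            has_real_derivative_powr[OF t_pos, of "r + 1"]], of k] DK]
      by (simp add: mult.assoc)
    have sol: "time_deriv t0 x' t + (\<alpha> / t powr r) *\<^sub>R x' t
          = - gradient f (x t) - transpose A *v (l t + (k * t) *\<^sub>R l' t) - transpose A *v R t"
      "time_deriv t0 y' t + (\<alpha> / t powr r) *\<^sub>R y' t
          = - gradient g (y t) - transpose B *v (l t + (k * t) *\<^sub>R l' t) - transpose B *v R t"
      "time_deriv t0 l' t + (\<alpha> / t powr r) *\<^sub>R l' t
          = A *v (x t + (k * t) *\<^sub>R x' t) + B *v (y t + (k * t) *\<^sub>R y' t) - b"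
      using assms(12) t unfolding global_solution_def Let_def
      by (auto simp: x'_def y'_def l'_def R_def assms(10) \<delta> simp del: transpose_matrix_vector)
    define Sx where "Sx = inner (time_deriv t0 x' t + (\<alpha> / t powr r) *\<^sub>R x' t) (x t - xs + (k * t) *\<^sub>R x' t)"
    define Sy where "Sy = inner (time_deriv t0 y' t + (\<alpha> / t powr r) *\<^sub>R y' t) (y t - ys + (k * t) *\<^sub>R y' t)"
    define Sl where "Sl = inner (time_deriv t0 l' t + (\<alpha> / t powr r) *\<^sub>R l' t) (l t - ls + (k * t) *\<^sub>R l' t)"
    define Q where "Q = inner (Gx t) (x t - xs) + inner (Gy t) (y t - ys)"
    have "Sx + Sy + Sl = - Q - k * t * K'"
      unfolding Sx_def Sy_def Sl_def Q_def K'_def sol Gx_def Gy_def R_def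
      by (rule coupling_cancels[OF feas])
    then have Sl: "Sl = - Q - k * t * K' - Sx - Sy" by simp
    have pw: "t powr (r + 1) = t * t powr r" using t_pos by (simp add: powr_add)
    note D = component_energy_has_derivative[OF t_pos C2_from_derivatives(1)[OF _ t] C2_from_derivatives(2)[OF _ t]]
    note Dx = D[OF C2(1) C2(1), of \<alpha> r k xs, folded x'_def, folded Sx_def]
    note Dy = D[OF C2(2) C2(2), of \<alpha> r k ys, folded y'_def, folded Sy_def]
    note Dl = D[OF C2(3) C2(3), of \<alpha> r k ls, folded l'_def, folded Sl_def]
    show ?thesis
      unfolding E_def[abs_def]
      by (rule DERIV_cong[OF DERIV_add[OF DkK DERIV_add[OF DERIV_add[OF Dx Dy] Dl]]])
         (simp only: E'_def N_def V_def Q_def[symmetric] Sl pw, simp add: field_simps)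
  qed
  have E'_upper: "E' t \<le> - (1 - k * (r + 1)) * (t powr r * K t)
      - 1 / 2 * (t powr r * (norm (R t))\<^sup>2) - \<alpha> * k / 2 * (t * N t)"
    if t: "T \<le> t" for t
  proof -
    have "4 / (\<alpha> * k) \<le> t" using t T by linarith
    then have t1: "1 \<le> t" "4 \<le> \<alpha> * k * t"
      using t T \<open>t0 \<ge> 1\<close> \<open>\<alpha> > 0\<close> k(1) by (simp_all add: pos_divide_le_eq mult.commute)
    define p where "p = t powr r"
    have p: "0 \<le> p" "p \<le> 1"
      using t1 powr_mono[OF \<open>r \<le> 0\<close>, of t] by (auto simp: p_def)
    \<comment> \<open>The terms that compete with the damping have coefficient at most \<open>3 / 2\<close>, while
      \<open>\<alpha> * k * t / 2\<close> is at least \<open>2\<close>.\<close>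
    have "(1 + k * (r + 1) / 2) * p \<le> (1 + 1 / 2) * 1"
      using p k by (intro mult_mono) auto
    then have "\<alpha> * k * t / 2 \<le> \<alpha> * k * t - (1 + k * (r + 1) / 2) * p"
      using t1 by simp
    moreover have "0 \<le> N t" by (simp add: N_def)
    ultimately have "\<alpha> * k * t / 2 * N t \<le> (\<alpha> * k * t - (1 + k * (r + 1) / 2) * p) * N t"
      by (rule mult_right_mono)
    moreover have "0 \<le> r * (r - 1) / 2 * t powr (r - 2) * V t"
      using \<open>r \<le> 0\<close> by (intro mult_nonneg_nonneg) (auto simp: V_def mult_nonpos_nonpos)
    moreover have "p * (K t + (norm (R t))\<^sup>2 / 2) \<le> p * (inner (Gx t) (x t - xs) + inner (Gy t) (y t - ys))"
      using pairing p(1) by (rule mult_left_mono)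
    moreover have "p * (K t + (norm (R t))\<^sup>2 / 2) = p * K t + 1 / 2 * (p * (norm (R t))\<^sup>2)"
      "(1 - k * (r + 1)) * (p * K t) = p * K t - k * (r + 1) * p * K t"
      "\<alpha> * k * t / 2 * N t = \<alpha> * k / 2 * (t * N t)"
      by (simp_all add: algebra_simps)
    ultimately show ?thesis
      unfolding E'_def p_def[symmetric] by linarith
  qed
  have E_lower: "k * t powr (r + 1) * K t + k / 4 * t powr (r + 1) * N t \<le> E t" if t: "T \<le> t" for t
  proof -
    have "1 \<le> t" "4 / (\<alpha> * k) \<le> t" using t T \<open>t0 \<ge> 1\<close> by auto
    note lb = component_energy_lower_bound[OF this(1) \<open>r \<le> 0\<close> \<open>\<alpha> > 0\<close> k(1) this(2)]
    show ?thesis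
      using lb[of x' xs x] lb[of y' ys y] lb[of l' ls l]
      unfolding E_def N_def by (simp add: algebra_simps)
  qed
  have E_deriv_T: "(E has_real_derivative E' t) (at t within {T..})" if "T \<le> t" for t
    using E_deriv T(1) that by (auto intro: DERIV_subset[where s = "{t0..}"])
  have N_nonneg: "0 \<le> N t" for t by (simp add: N_def)
  have E_nonneg: "0 \<le> E t" if "T \<le> t" for t
    using k(1) K_nonneg N_nonneg by (intro order_trans[OF _ E_lower[OF that]]) simp
  have rate_nonneg: "0 \<le> (1 - k * (r + 1)) * (t powr r * K t)"
    "0 \<le> 1 / 2 * (t powr r * (norm (R t))\<^sup>2)" "T \<le> t \<Longrightarrow> 0 \<le> \<alpha> * k / 2 * (t * N t)" for t
    using k K_nonneg N_nonneg T \<open>t0 \<ge> 1\<close> \<open>\<alpha> > 0\<close> by simp_all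
  have E_decreasing: "E t \<le> E T" if "T \<le> t" for t
  proof -
    have "integral {T..t} (\<lambda>_. 0 :: real) \<le> E T - E t"
    proof (rule dissipation_integral_bound[OF that _ E_deriv_T])
      fix s assume "T \<le> s"
      then show "E' s \<le> - 0" using E'_upper[of s] rate_nonneg[of s] by linarith
    qed auto
    then show ?thesis by simp
  qed

  define C where "C = E T / k"
  have C: "0 \<le> C" using E_nonneg[of T] k by (simp add: C_def)
  have rates: "K t \<le> C * t powr (- (r + 1))" "N t \<le> 4 * C * t powr (- (r + 1))" if t: "T \<le> t" for t
  proof -
    define q where "q = t powr (r + 1)"
    have q: "0 < q" using t T \<open>t0 \<ge> 1\<close> by (simp add: q_def)
    have inv: "t powr (- (r + 1)) = 1 / q" unfolding q_def by (rule powr_minus_divide)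
    have "k * q * K t + k / 4 * q * N t \<le> E T"
      using E_lower[OF t] E_decreasing[OF t] by (simp add: q_def)
    moreover have "0 \<le> k * q * K t" "0 \<le> k / 4 * q * N t"
      using k q K_nonneg N_nonneg by simp_all
    ultimately have "k * q * K t \<le> E T" "k / 4 * q * N t \<le> E T"
      by linarith+
    then show "K t \<le> C * t powr (- (r + 1))" "N t \<le> 4 * C * t powr (- (r + 1))"
      unfolding inv using q k(1) by (simp_all add: C_def field_simps)
  qed
  have R_rate: "norm (R t) \<le> sqrt (2 * C) * t powr (- ((r + 1) / 2))" if "T \<le> t" for t
    using K_lower[of t] rates(1)[OF that] C by (intro sqrt_rate) auto
  have velocity_rate: "norm (x' t) + norm (y' t) + norm (l' t) \<le> sqrt (12 * C) * t powr (- ((r + 1) / 2))"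
    if "T \<le> t" for t
  proof (rule sqrt_rate)
    have "(p + q + s)\<^sup>2 \<le> 3 * (p\<^sup>2 + q\<^sup>2 + s\<^sup>2)" for p q s :: real
      using zero_le_power2[of "p - q"] zero_le_power2[of "p - s"] zero_le_power2[of "q - s"]
      by (simp add: power2_eq_square algebra_simps)
    then have "(norm (x' t) + norm (y' t) + norm (l' t))\<^sup>2 \<le> 3 * N t"
      by (simp add: N_def)
    then show "(norm (x' t) + norm (y' t) + norm (l' t))\<^sup>2 \<le> 12 * C * t powr (- (r + 1))"
      using rates(2)[OF that] by simp
  qed (use C in simp)

  have cont: "continuous_on {t0..} K" "continuous_on {t0..} R" "continuous_on {t0..} N"
    "continuous_on {t0..} (\<lambda>t. t powr r)"
  proof -
    have "continuous_on UNIV f" "continuous_on UNIV g"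
      using df dg unfolding gderiv_def by (meson has_derivative_at_withinI has_derivative_continuous_on)+
    then have f_cont: "continuous_on {t0..} (\<lambda>t. f (x t))"
      and g_cont: "continuous_on {t0..} (\<lambda>t. g (y t))"
      using C2_from_continuous(1)[OF C2(1)] C2_from_continuous(1)[OF C2(2)]
      by (auto intro: continuous_on_compose2)
    show R: "continuous_on {t0..} R"
      unfolding R_def[abs_def]
      by (intro continuous_intros C2_from_continuous C2
          bounded_linear.continuous_on[OF matrix_vector_mul_bounded_linear])
    show "continuous_on {t0..} K"
      unfolding K_def[abs_def] aug_Lagrangian_def R_def[symmetric]
      by (intro continuous_intros f_cont g_cont R)
    show "continuous_on {t0..} N"
      unfolding N_def[abs_def] x'_def y'_def l'_def
      by (intro continuous_intros C2_from_continuous C2)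
    show "continuous_on {t0..} (\<lambda>t. t powr r)"
      using \<open>t0 \<ge> 1\<close> by (intro continuous_intros) auto
  qed

  note dissipation = set_integrable_of_dissipation[OF _ T(1) _ _ E_deriv_T _ E_nonneg]
  have "set_integrable lborel {t0..} (\<lambda>t. t powr r * K t)"
  proof (rule dissipation[where c = "1 - k * (r + 1)"])
    fix t assume "T \<le> t"
    then show "E' t \<le> - ((1 - k * (r + 1)) * (t powr r * K t))"
      using E'_upper[of t] rate_nonneg[of t] by linarith
  qed (use k K_nonneg cont in \<open>auto intro!: continuous_intros\<close>)
  moreover have "set_integrable lborel {t0..} (\<lambda>t. t powr r * (norm (R t))\<^sup>2)"
  proof (rule dissipation[where c = "1 / 2"])
    fix t assume "T \<le> t"
    then show "E' t \<le> - (1 / 2 * (t powr r * (norm (R t))\<^sup>2))"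
      using E'_upper[of t] rate_nonneg[of t] by linarith
  qed (use cont in \<open>auto intro!: continuous_intros\<close>)
  moreover have "set_integrable lborel {t0..} (\<lambda>t. t * N t)"
  proof (rule dissipation[where c = "\<alpha> * k / 2"])
    fix t assume "T \<le> t"
    then show "E' t \<le> - (\<alpha> * k / 2 * (t * N t))"
      using E'_upper[of t] rate_nonneg[of t] by linarith
  qed (use k \<open>\<alpha> > 0\<close> T \<open>t0 \<ge> 1\<close> N_nonneg cont in \<open>auto intro!: continuous_intros\<close>)
  moreover have "K \<in> O[at_top](\<lambda>t. t powr (- (r + 1)))"
    using rates(1) K_nonneg
    by (intro bigoI[where c = C] eventually_mono[OF eventually_ge_at_top[of T]]) auto
  moreover have "(\<lambda>t. norm (R t)) \<in> O[at_top](\<lambda>t. t powr (- ((r + 1) / 2)))"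
    using R_rate
    by (intro bigoI[where c = "sqrt (2 * C)"] eventually_mono[OF eventually_ge_at_top[of T]]) auto
  moreover have "(\<lambda>t. norm (x' t) + norm (y' t) + norm (l' t))
      \<in> O[at_top](\<lambda>t. t powr (- ((r + 1) / 2)))"
    using velocity_rate
    by (intro bigoI[where c = "sqrt (12 * C)"] eventually_mono[OF eventually_ge_at_top[of T]]) auto
  ultimately show ?thesis
    unfolding K_def R_def N_def x'_def y'_def l'_def by simp
qed

end
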